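(* Every $T_2$ topological space is locally Hausdorff, and every locally Hausdorff topological space is $T_1$.
   Context: A space is locally Hausdorff ($lH$) if every point has a neighborhood that is $T_2$ (Hausdorff) in the subspace topology. *)

theory Defs
  imports "HOL-Analysis.Analysis"
begin

(* A neighbourhood of x is any subset N of the space, not necessarily open,
   that contains an open set containing x. *)
definition locally_Hausdorff_space :: "'a topology \<Rightarrow> bool" where
  "locally_Hausdorff_space X \<longleftrightarrow>
     (\<forall>x \<in> topspace X. \<exists>U N. openin X U \<and> x \<in> U \<and> U \<subseteq> N \<and> N \<subseteq> topspace X \<and>
        Hausdorff_space (subtopology X N))"

end

theory Submission
  imports Defs
begin

text \<open>
  The whole space witnesses local Hausdorffness of a Hausdorff space. Conversely, let \<open>N\<close> be a
  Hausdorff neighbourhood of \<open>x\<close> containing an open \<open>U\<close> around \<open>x\<close>, and let \<open>y \<noteq> x\<close>. A point \<open>y\<close>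
  outside \<open>U\<close> is already excluded by \<open>U\<close>; a point \<open>y\<close> inside \<open>U\<close> lies in \<open>N\<close>, where a relatively
  open set around \<open>x\<close> avoids it, and so does every open set of the whole space with that trace on \<open>N\<close>.
\<close>

lemma Hausdorff_imp_locally_Hausdorff_space:
  assumes "Hausdorff_space X"
  shows "locally_Hausdorff_space X"
  unfolding locally_Hausdorff_space_def
proof (intro ballI exI conjI)
  fix x assume "x \<in> topspace X"
  then show "x \<in> topspace X" .
  show "Hausdorff_space (subtopology X (topspace X))"
    using assms by simp
qed simp_all

lemma locally_Hausdorff_imp_t1_space:
  assumes "locally_Hausdorff_space X"
  shows "t1_space X"
  unfolding t1_space_def
proof (intro ballI impI)
  fix x y assume x: "x \<in> topspace X" and y: "y \<in> topspace X" and "x \<noteq> y"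
  obtain U N where U: "openin X U" "x \<in> U" "U \<subseteq> N" "N \<subseteq> topspace X"
    and N: "Hausdorff_space (subtopology X N)"
    using assms x unfolding locally_Hausdorff_space_def by meson
  show "\<exists>W. openin X W \<and> x \<in> W \<and> y \<notin> W"
  proof (cases "y \<in> U")
    case True
    have "t1_space (subtopology X N)"
      using N by (rule Hausdorff_imp_t1_space)
    moreover have "x \<in> topspace (subtopology X N)" "y \<in> topspace (subtopology X N)"
      using U True x y by auto
    ultimately obtain V where V: "openin (subtopology X N) V" "x \<in> V" "y \<notin> V"
      using \<open>x \<noteq> y\<close> unfolding t1_space_def by blast
    obtain T where T: "openin X T" "V = T \<inter> N"
      using V(1) unfolding openin_subtopology by blast
    \<comment> \<open>The trace \<open>T \<inter> N\<close> need not be open in \<open>X\<close>, but \<open>T\<close> itself avoids \<open>y\<close>, since \<open>y \<in> N\<close>.\<close>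
    have "x \<in> T" "y \<notin> T"
      using T(2) V(2,3) U(3) True by auto
    with T(1) show ?thesis by blast
  next
    case False
    then show ?thesis using U by blast
  qed
qed

theorem theorem56:
  shows "(\<forall>X :: 'a topology. Hausdorff_space X \<longrightarrow> locally_Hausdorff_space X) \<and>
         (\<forall>X :: 'a topology. locally_Hausdorff_space X \<longrightarrow> t1_space X)"
  by (simp add: Hausdorff_imp_locally_Hausdorff_space locally_Hausdorff_imp_t1_space)

end
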